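(* Fix an integer $r\ge2$ and a collection of non-negative integers $\boldsymbol\ell=\{\ell_{ij}\}_{1\le i<j\le r}$. Then $$1+\sum_{\boldsymbol n=(n_1,\dots,n_r)\in\mathbb{Z}_{\ge0}^r,\ \boldsymbol n\ne\boldsymbol0}(x-1)^{\kappa(\boldsymbol\ell,\boldsymbol n)}\,\mathrm{Tutte}\bigl(K^{(\boldsymbol\ell)}_{n_1,\dots,n_r},x,y\bigr)\frac{t_1^{n_1}}{n_1!}\cdots\frac{t_r^{n_r}}{n_r!}$$ $$=\left(\sum_{\boldsymbol m=(m_1,\dots,m_r)\in\mathbb{Z}_{\ge0}^r}y^{\sum_{1\le i<j\le r}\ell_{ij}m_im_j}(y-1)^{-|\boldsymbol m|}\frac{t_1^{m_1}}{m_1!}\cdots\frac{t_r^{m_r}}{m_r!}\right)^{(x-1)(y-1)},$$ where $\kappa(\boldsymbol\ell,\boldsymbol n)$ is the number of connected components of the graph $K^{(\boldsymbol\ell)}_{n_1,\dots,n_r}$.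
   Context: The $\boldsymbol\ell$-weighted complete multipartite graph $K^{(\boldsymbol\ell)}_{n_1,\dots,n_r}$ has vertex set the disjoint union of sets $S_1,\dots,S_r$ with $|S_j|=n_j$; for $i<j$, every $\alpha\in S_i$ and every $\beta\in S_j$ are joined by exactly $\ell_{ij}$ parallel edges, and there are no other edges. $\mathrm{Tutte}(\Gamma,x,y)=\sum_{A\subset E}(x-1)^{\kappa(A)-\kappa(E)}(y-1)^{\kappa(A)+|A|-|V|}$ is the Tutte polynomial of $\Gamma=(V,E)$ ($\kappa(A)$ is the number of connected components of $(V,A)$). $|\boldsymbol m|=m_1+\cdots+m_r$. The identity is one of formal power series in $t_1,\dots,t_r$; the power on the right is $\exp((x-1)(y-1)\log(\cdot))$, the base having constant term $1$. *)

theory Defs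
  imports
    "HOL-Computational_Algebra.Computational_Algebra"
    "HOL-Library.Cardinality"
    "HOL-Library.Function_Algebras"
begin

section \<open>Formal power series in finitely many variables\<close>

text \<open>
  The variables \<open>t\<^sub>i\<close> are indexed by a finite type \<open>'i\<close>; a monomial is given by its
  exponent vector \<open>n :: 'i \<Rightarrow> nat\<close>, and exponent vectors are ordered pointwise.
\<close>

typedef ('i, 'a) mfps = "UNIV :: (('i \<Rightarrow> nat) \<Rightarrow> 'a) set"
  morphisms mfps_nth Abs_mfps
  by simp

declare Abs_mfps_inverse [simplified, simp]

lemma mfps_eq_iff: "f = g \<longleftrightarrow> (\<forall>n. mfps_nth f n = mfps_nth g n)"
  by (simp add: mfps_nth_inject [symmetric] fun_eq_iff)

lemma finite_atMost_exponent [simp]: "finite {..n :: 'i::finite \<Rightarrow> nat}"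
proof (rule finite_subset)
  show "{..n} \<subseteq> Pi\<^sub>E UNIV (\<lambda>i. {..n i})"
    by (auto simp: le_fun_def)
qed (auto intro: finite_PiE)

lemma sum_exponent_assoc:
  fixes h :: "('i::finite \<Rightarrow> nat) \<Rightarrow> ('i \<Rightarrow> nat) \<Rightarrow> ('i \<Rightarrow> nat) \<Rightarrow> 'a::comm_monoid_add"
  shows "(\<Sum>m\<le>n. \<Sum>a\<le>m. h a (m - a) (n - m)) = (\<Sum>a\<le>n. \<Sum>b\<le>n - a. h a b (n - a - b))"
proof -
  have "(\<Sum>m\<le>n. \<Sum>a\<le>m. h a (m - a) (n - m)) =
      (\<Sum>(m, a)\<in>(SIGMA m:{..n}. {..m}). h a (m - a) (n - m))"
    by (rule sum.Sigma) auto
  also have "\<dots> = (\<Sum>(a, b)\<in>(SIGMA a:{..n}. {..n - a}). h a b (n - a - b))"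
  proof (rule sum.reindex_bij_witness
      [where i = "\<lambda>(a, b). (a + b, a)" and j = "\<lambda>(m, a). (a, m - a)"])
    fix p assume "p \<in> (SIGMA m:{..n}. {..m})"
    then obtain m a where p: "p = (m, a)" and le: "m \<le> n" "a \<le> m"
      by auto
    have "n - a - (m - a) = n - m"
      using le by (simp add: le_fun_def fun_eq_iff)
    then show "(case case p of (m, a) \<Rightarrow> (a, m - a) of (a, b) \<Rightarrow> h a b (n - a - b)) =
        (case p of (m, a) \<Rightarrow> h a (m - a) (n - m))"
      by (simp add: p)
    show "(case p of (m, a) \<Rightarrow> (a, m - a)) \<in> (SIGMA a:{..n}. {..n - a})"
      using le by (auto simp: p le_fun_def diff_le_mono intro: le_trans)
  qed (auto simp: le_fun_def fun_eq_iff le_diff_conv2 add.commute)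
  also have "\<dots> = (\<Sum>a\<le>n. \<Sum>b\<le>n - a. h a b (n - a - b))"
    by (rule sum.Sigma [symmetric]) auto
  finally show ?thesis .
qed

lemma sum_exponent_swap:
  fixes h :: "('i::finite \<Rightarrow> nat) \<Rightarrow> ('i \<Rightarrow> nat) \<Rightarrow> 'a::comm_monoid_add"
  shows "(\<Sum>m\<le>n. h m (n - m)) = (\<Sum>m\<le>n. h (n - m) m)"
  by (rule sum.reindex_bij_witness [where i = "\<lambda>m. n - m" and j = "\<lambda>m. n - m"])
    (auto simp: le_fun_def fun_eq_iff intro!: arg_cong2 [where f = h])

instantiation mfps :: (finite, comm_ring_1) comm_ring_1
begin

definition "0 = Abs_mfps (\<lambda>_. 0)"
definition "1 = Abs_mfps (\<lambda>n. if n = 0 then 1 else 0)"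
definition "f + g = Abs_mfps (\<lambda>n. mfps_nth f n + mfps_nth g n)"
definition "f - g = Abs_mfps (\<lambda>n. mfps_nth f n - mfps_nth g n)"
definition "- f = Abs_mfps (\<lambda>n. - mfps_nth f n)"
definition "f * g = Abs_mfps (\<lambda>n. \<Sum>m\<le>n. mfps_nth f m * mfps_nth g (n - m))"

instance
proof
  fix f g h :: "('a, 'b) mfps"
  show "f * g * h = f * (g * h)"
    using sum_exponent_assoc
      [of "\<lambda>a b c. mfps_nth f a * mfps_nth g b * mfps_nth h c"]
    by (simp add: times_mfps_def mfps_eq_iff sum_distrib_left sum_distrib_right mult.assoc)
  show "f * g = g * f"
    using sum_exponent_swap [of "\<lambda>a b. mfps_nth f a * mfps_nth g b"]
    by (simp add: times_mfps_def mfps_eq_iff mult.commute)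
  show "1 * f = f"
  proof -
    have "(\<Sum>m\<le>n. (if m = 0 then 1 else 0) * mfps_nth f (n - m)) = mfps_nth f n" for n
    proof -
      have "(\<Sum>m\<le>n. (if m = 0 then 1 else 0) * mfps_nth f (n - m)) =
          (\<Sum>m\<le>n. if m = 0 then mfps_nth f (n - m) else 0)"
        by (rule sum.cong) auto
      also have "\<dots> = mfps_nth f (n - 0)"
        by (subst sum.delta) (auto simp: le_fun_def)
      also have "n - 0 = n"
        by (simp add: fun_eq_iff)
      finally show ?thesis .
    qed
    then show ?thesis
      by (simp add: times_mfps_def one_mfps_def mfps_eq_iff)
  qed
  show "(f + g) * h = f * h + g * h"
    by (simp add: times_mfps_def plus_mfps_def mfps_eq_iff distrib_right sum.distrib)
  show "(0 :: ('a, 'b) mfps) \<noteq> 1"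
    by (auto simp: zero_mfps_def one_mfps_def mfps_eq_iff)
qed (simp_all add: zero_mfps_def plus_mfps_def minus_mfps_def uminus_mfps_def
      mfps_eq_iff algebra_simps)

end

definition mfps_const :: "'a::zero \<Rightarrow> ('i, 'a) mfps" where
  "mfps_const c = Abs_mfps (\<lambda>n. if n = 0 then c else 0)"

definition total_degree :: "('i::finite \<Rightarrow> nat) \<Rightarrow> nat" where
  "total_degree n = (\<Sum>i\<in>UNIV. n i)"

text \<open>
  The substitution \<open>F(f) = (\<Sum>k. F\<^sub>k f\<^sup>k)\<close> of a series \<open>f\<close> with zero constant term: \<open>f\<^sup>k\<close> has
  no monomials of total degree below \<open>k\<close>, so the coefficient at \<open>n\<close> only involves
  \<open>k \<le> total_degree n\<close>.  As for \<^const>\<open>fps_compose\<close>, the value is only meaningful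
  when the constant term of \<open>f\<close> is zero.
\<close>
definition mfps_subst :: "'a::comm_ring_1 fps \<Rightarrow> ('i::finite, 'a) mfps \<Rightarrow> ('i, 'a) mfps" where
  "mfps_subst F f = Abs_mfps (\<lambda>n. \<Sum>k\<le>total_degree n. fps_nth F k * mfps_nth (f ^ k) n)"

definition mfps_exp :: "('i::finite, 'a::field_char_0) mfps \<Rightarrow> ('i, 'a) mfps" where
  "mfps_exp f = mfps_subst (fps_exp 1) f"

text \<open>Logarithm of a series with constant term 1; \<^term>\<open>fps_ln 1\<close> is the series of \<open>log (1 + X)\<close>.\<close>
definition mfps_ln :: "('i::finite, 'a::field_char_0) mfps \<Rightarrow> ('i, 'a) mfps" where
  "mfps_ln f = mfps_subst (fps_ln 1) (f - 1)"

definition mfps_powr :: "('i::finite, 'a::field_char_0) mfps \<Rightarrow> 'a \<Rightarrow> ('i, 'a) mfps" where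
  "mfps_powr f c = mfps_exp (mfps_const c * mfps_ln f)"

definition exponent_fact :: "('i::finite \<Rightarrow> nat) \<Rightarrow> nat" where
  "exponent_fact n = (\<Prod>i\<in>UNIV. fact (n i))"

text \<open>
  Fields of fractions inherit characteristic 0, so that a statement about arbitrary elements
  of a field of characteristic 0 applies to the two indeterminates
  in \<^typ>\<open>rat poly poly fract\<close>.
\<close>
instance fract :: ("{idom, ring_char_0}") field_char_0
proof
  have "of_nat n = Fract (of_nat n :: 'a) 1" for n
    by (induction n) (simp_all add: Zero_fract_def One_fract_def)
  then show "inj (of_nat :: nat \<Rightarrow> 'a fract)"
    by (auto simp: inj_on_def eq_fract)
qed


section \<open>Multigraphs and the Tutte polynomial\<close>

text \<open>An edge \<open>e\<close> joins the vertices in \<open>ends \<Gamma> e\<close>, a set with one (loop) or two elements.\<close>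
record ('v, 'e) multigraph =
  verts :: "'v set"
  edges :: "'e set"
  ends :: "'e \<Rightarrow> 'v set"

definition adjacency :: "('v, 'e) multigraph \<Rightarrow> 'e set \<Rightarrow> 'v rel" where
  "adjacency \<Gamma> A = {(u, v). \<exists>e\<in>A. ends \<Gamma> e = {u, v}}"

definition connectivity :: "('v, 'e) multigraph \<Rightarrow> 'e set \<Rightarrow> 'v rel" where
  "connectivity \<Gamma> A = {(u, v). u \<in> verts \<Gamma> \<and> v \<in> verts \<Gamma> \<and> (u, v) \<in> (adjacency \<Gamma> A)\<^sup>*}"

text \<open>The number \<open>\<kappa>(A)\<close> of connected components of the spanning subgraph with edge set \<open>A\<close>.\<close>
definition num_components :: "('v, 'e) multigraph \<Rightarrow> 'e set \<Rightarrow> nat" where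
  "num_components \<Gamma> A = card (verts \<Gamma> // connectivity \<Gamma> A)"

text \<open>
  For a finite graph \<open>\<kappa>(A) \<ge> \<kappa>(E)\<close> and \<open>\<kappa>(A) + |A| \<ge> |V|\<close>, so the subtractions do not truncate.
\<close>
definition Tutte :: "('v, 'e) multigraph \<Rightarrow> 'a::comm_ring_1 \<Rightarrow> 'a \<Rightarrow> 'a" where
  "Tutte \<Gamma> x y =
    (\<Sum>A\<in>Pow (edges \<Gamma>).
      (x - 1) ^ (num_components \<Gamma> A - num_components \<Gamma> (edges \<Gamma>)) *
      (y - 1) ^ (num_components \<Gamma> A + card A - card (verts \<Gamma>)))"

text \<open>
  \<open>S\<^sub>j = {j} \<times> {0..<n j}\<close>, and \<open>(\<alpha>, \<beta>, c)\<close> with \<open>c < l\<^sub>i\<^sub>j\<close> are the parallel edges joining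
  \<open>\<alpha> \<in> S\<^sub>i\<close> and \<open>\<beta> \<in> S\<^sub>j\<close> for \<open>i < j\<close>.  Only the values \<open>l i j\<close> with \<open>i < j\<close> are used.
\<close>
definition weighted_multipartite ::
  "('i::linorder \<Rightarrow> 'i \<Rightarrow> nat) \<Rightarrow> ('i \<Rightarrow> nat) \<Rightarrow>
    ('i \<times> nat, ('i \<times> nat) \<times> ('i \<times> nat) \<times> nat) multigraph" where
  "weighted_multipartite l n =
    (let V = (SIGMA j:UNIV. {..<n j}) in
      \<lparr>verts = V,
       edges = {(\<alpha>, \<beta>, c). \<alpha> \<in> V \<and> \<beta> \<in> V \<and> fst \<alpha> < fst \<beta> \<and> c < l (fst \<alpha>) (fst \<beta>)},
       ends = (\<lambda>(\<alpha>, \<beta>, c). {\<alpha>, \<beta>})\<rparr>)"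

end

theory Submission
  imports Defs
begin

text \<open>
  Write \<open>q = (x - 1) (y - 1)\<close>.  Multiplied by \<open>(x - 1)\<^bsup>\<kappa>(E)\<^esup>\<close>, the Tutte polynomial of a finite graph
  with vertex set \<open>V\<close> becomes the Fortuin--Kasteleyn sum
  \<open>Z(q) = (\<Sum>A\<subseteq>E. q\<^bsup>\<kappa>(A)\<^esup> (y - 1)\<^bsup>|A|\<^esup>)\<close> divided by \<open>(y - 1)\<^bsup>|V|\<^esup>\<close>
  (\<open>Tutte_eq_sum_num_components\<close>).  The claim is that the exponential generating function of
  these quotients over all part sizes is \<open>F\<^sup>q\<close>, where \<open>F\<close> is the series for \<open>q = 1\<close>, in which
  \<open>Z(1) = y\<^bsup>|E|\<^esup>\<close>.

  Suppose first that \<open>q = k\<close> is a natural number.  Then \<open>k\<^bsup>\<kappa>(A)\<^esup>\<close> is the number of \<open>k\<close>-colourings of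
  \<open>V\<close> that are constant on the components of \<open>(V, A)\<close>, so that exchanging the two summations
  turns \<open>Z(k)\<close> into the sum of \<open>y\<close> to the number of monochromatic edges, over all colourings
  of \<open>V\<close> with \<open>k\<close> colours (\<open>sum_num_components_eq_sum_colourings\<close>).  A colouring is an ordered
  partition of \<open>V\<close> into \<open>k\<close> colour classes, the monochromatic edges are the edges inside the
  classes, and each class induces a weighted complete multipartite graph again.  Since
  exponential generating functions multiply according to such partitions, the sum is,
  up to the factor \<open>n! (y - 1)\<^bsup>|n|\<^esup>\<close>, a coefficient of \<open>F\<^sup>k\<close> (\<open>sum_colourings_eq_power_edge_series\<close>).

  For a general \<open>q\<close>, fix a monomial.  Its coefficients on both sides are polynomials in \<open>q\<close>
  (\<open>mfps_nth_powr_eq_poly\<close>), and they agree at the infinitely many natural numbers, where the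
  power defined by exponential and logarithm is the ordinary one (\<open>mfps_powr_of_nat\<close>).
\<close>

section \<open>Substitution into one-variable power series\<close>

lemma mfps_nth_one: "mfps_nth 1 n = (if n = 0 then 1 else 0)"
  by (simp add: one_mfps_def)

lemma mfps_nth_add [simp]: "mfps_nth (f + g) n = mfps_nth f n + mfps_nth g n"
  by (simp add: plus_mfps_def)

lemma mfps_nth_diff [simp]: "mfps_nth (f - g) n = mfps_nth f n - mfps_nth g n"
  by (simp add: minus_mfps_def)

lemma mfps_nth_mult: "mfps_nth (f * g) n = (\<Sum>m\<le>n. mfps_nth f m * mfps_nth g (n - m))"
  by (simp add: times_mfps_def)

lemma mfps_nth_const_mult [simp]:
  fixes f :: "('i::finite, 'a::comm_ring_1) mfps"
  shows "mfps_nth (mfps_const c * f) n = c * mfps_nth f n"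
proof -
  have "mfps_nth (mfps_const c * f) n = (\<Sum>m\<le>n. if m = 0 then c * mfps_nth f (n - m) else 0)"
    unfolding mfps_nth_mult mfps_const_def by (rule sum.cong) auto
  also have "\<dots> = c * mfps_nth f (n - 0)"
    by (subst sum.delta) (auto simp: le_fun_def)
  also have "n - 0 = n"
    by (simp add: fun_eq_iff)
  finally show ?thesis .
qed

lemma mfps_nth_const_mult_power:
  fixes f :: "('i::finite, 'a::comm_ring_1) mfps"
  shows "mfps_nth ((mfps_const c * f) ^ k) n = c ^ k * mfps_nth (f ^ k) n"
proof (induction k arbitrary: n)
  case (Suc k)
  have eq: "(mfps_const c * f) ^ Suc k = mfps_const c * (f * (mfps_const c * f) ^ k)"
    by (simp add: mult.assoc)
  have "mfps_nth ((mfps_const c * f) ^ Suc k) n =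
      c * (\<Sum>m\<le>n. mfps_nth f m * (c ^ k * mfps_nth (f ^ k) (n - m)))"
    unfolding eq mfps_nth_const_mult unfolding mfps_nth_mult Suc.IH ..
  then show ?case
    by (simp add: mfps_nth_mult sum_distrib_left mult_ac)
qed (simp add: mfps_nth_one)

lemma total_degree_diff_less:
  assumes "m \<le> n" "m \<noteq> 0"
  shows "total_degree (n - m) < total_degree n"
proof -
  from assms(2) obtain i where "m i \<noteq> 0"
    by (auto simp: fun_eq_iff)
  moreover have "m i \<le> n i" for i
    using assms(1) by (simp add: le_fun_def)
  ultimately show ?thesis
    unfolding total_degree_def
    by (intro sum_strict_mono_ex1) (auto intro!: exI [of _ i] simp: less_le_trans diff_less)
qed

lemma mfps_nth_power_eq_0:
  fixes f :: "('i::finite, 'a::comm_ring_1) mfps"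
  assumes "mfps_nth f 0 = 0" "total_degree n < k"
  shows "mfps_nth (f ^ k) n = 0"
  using assms(2)
proof (induction k arbitrary: n)
  case (Suc k)
  have "mfps_nth f m * mfps_nth (f ^ k) (n - m) = 0" if "m \<le> n" for m
  proof (cases "m = 0")
    case False
    then have "total_degree (n - m) < k"
      using total_degree_diff_less [OF that] Suc.prems by simp
    then show ?thesis
      using Suc.IH by (metis mult_zero_right)
  qed (simp add: assms(1))
  then show ?case
    by (simp add: mfps_nth_mult)
qed simp

lemma mfps_nth_subst:
  fixes f :: "('i::finite, 'a::comm_ring_1) mfps"
  assumes "mfps_nth f 0 = 0" "total_degree n \<le> N"
  shows "mfps_nth (mfps_subst F f) n = (\<Sum>k\<le>N. fps_nth F k * mfps_nth (f ^ k) n)"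
proof -
  have "(\<Sum>k\<le>total_degree n. fps_nth F k * mfps_nth (f ^ k) n) =
      (\<Sum>k\<le>N. fps_nth F k * mfps_nth (f ^ k) n)"
    using assms by (intro sum.mono_neutral_left) (auto simp: mfps_nth_power_eq_0)
  then show ?thesis
    by (simp add: mfps_subst_def)
qed

lemma mfps_nth_subst_0 [simp]: "mfps_nth (mfps_subst F f) 0 = fps_nth F 0"
  by (simp add: mfps_subst_def total_degree_def mfps_nth_one)

lemma mfps_subst_1 [simp]: "mfps_subst 1 f = 1"
proof -
  have "(\<Sum>k\<le>N. fps_nth 1 k * mfps_nth (f ^ k) n) = mfps_nth 1 n" for N n
    by (subst sum.remove [of _ 0]) auto
  then show ?thesis
    by (simp add: mfps_eq_iff mfps_subst_def)
qed

lemma mfps_subst_X: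
  fixes f :: "('i::finite, 'a::comm_ring_1) mfps"
  assumes "mfps_nth f 0 = 0"
  shows "mfps_subst fps_X f = f"
proof -
  have "mfps_nth (mfps_subst fps_X f) n = mfps_nth f n" for n
    by (subst mfps_nth_subst [OF assms, of _ "Suc (total_degree n)"], simp,
        subst sum.remove [of _ 1]) auto
  then show ?thesis
    by (simp add: mfps_eq_iff)
qed

lemma mfps_subst_add: "mfps_subst (F + G) f = mfps_subst F f + mfps_subst G f"
  by (simp add: mfps_eq_iff mfps_subst_def distrib_right sum.distrib)

lemma mfps_subst_const_mult:
  "mfps_subst (fps_const c * F) f = mfps_const c * mfps_subst F f"
  by (simp add: mfps_eq_iff mfps_subst_def sum_distrib_left mult.assoc)

lemma mfps_subst_mult:
  fixes f :: "('i::finite, 'a::comm_ring_1) mfps"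
  assumes "mfps_nth f 0 = 0"
  shows "mfps_subst (F * G) f = mfps_subst F f * mfps_subst G f"
proof -
  have "mfps_nth (mfps_subst F f * mfps_subst G f) n = mfps_nth (mfps_subst (F * G) f) n" for n
  proof -
    define N where "N = total_degree n"
    define c where "c i j = fps_nth F i * fps_nth G j * mfps_nth (f ^ (i + j)) n" for i j
    have le: "total_degree m \<le> N" "total_degree (n - m) \<le> N" if "m \<le> n" for m
      using that by (auto simp: N_def total_degree_def le_fun_def intro!: sum_mono)
    have "mfps_nth (mfps_subst F f * mfps_subst G f) n =
        (\<Sum>m\<le>n. (\<Sum>i\<le>N. fps_nth F i * mfps_nth (f ^ i) m) *
          (\<Sum>j\<le>N. fps_nth G j * mfps_nth (f ^ j) (n - m)))"
      by (simp add: mfps_nth_mult mfps_nth_subst [OF assms le(1)] mfps_nth_subst [OF assms le(2)])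
    also have "\<dots> = (\<Sum>m\<le>n. \<Sum>i\<le>N. \<Sum>j\<le>N.
        fps_nth F i * fps_nth G j * (mfps_nth (f ^ i) m * mfps_nth (f ^ j) (n - m)))"
      by (simp add: sum_product mult_ac)
    also have "\<dots> = (\<Sum>i\<le>N. \<Sum>m\<le>n. \<Sum>j\<le>N.
        fps_nth F i * fps_nth G j * (mfps_nth (f ^ i) m * mfps_nth (f ^ j) (n - m)))"
      by (rule sum.swap)
    also have "\<dots> = (\<Sum>i\<le>N. \<Sum>j\<le>N. \<Sum>m\<le>n.
        fps_nth F i * fps_nth G j * (mfps_nth (f ^ i) m * mfps_nth (f ^ j) (n - m)))"
      by (intro sum.cong refl sum.swap)
    also have "\<dots> = (\<Sum>i\<le>N. \<Sum>j\<le>N. c i j)"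
      by (simp add: c_def power_add mfps_nth_mult sum_distrib_left)
    also have "\<dots> = (\<Sum>(i, j)\<in>{..N} \<times> {..N}. c i j)"
      by (rule sum.cartesian_product)
    \<comment> \<open>The power \<open>f\<^sup>k\<close> does not contribute to degree \<open>N\<close> if \<open>k > N\<close>.\<close>
    also have "\<dots> = (\<Sum>(i, j)\<in>{(i, j). i + j \<le> N}. c i j)"
    proof (rule sum.mono_neutral_right)
      have "c i j = 0" if "\<not> i + j \<le> N" for i j
        using that by (simp add: c_def N_def mfps_nth_power_eq_0 [OF assms])
      then show "\<forall>p\<in>{..N} \<times> {..N} - {(i, j). i + j \<le> N}. (case p of (i, j) \<Rightarrow> c i j) = 0"
        by auto
    qed auto
    also have "\<dots> = (\<Sum>k\<le>N. \<Sum>i\<le>k. c i (k - i))"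
      by (rule sum.triangle_reindex_eq)
    also have "\<dots> = mfps_nth (mfps_subst (F * G) f) n"
      by (simp add: mfps_subst_def N_def [symmetric] fps_mult_nth sum_distrib_right c_def
          atLeast0AtMost)
    finally show ?thesis .
  qed
  then show ?thesis
    by (simp add: mfps_eq_iff)
qed

lemma mfps_subst_power:
  fixes f :: "('i::finite, 'a::comm_ring_1) mfps"
  assumes "mfps_nth f 0 = 0"
  shows "mfps_subst (F ^ k) f = mfps_subst F f ^ k"
  by (induction k) (simp_all add: mfps_subst_mult [OF assms])

lemma mfps_subst_compose:
  fixes f :: "('i::finite, 'a::comm_ring_1) mfps"
  assumes f: "mfps_nth f 0 = 0" and G: "fps_nth G 0 = 0"
  shows "mfps_subst (F oo G) f = mfps_subst F (mfps_subst G f)"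
proof -
  have "mfps_nth (mfps_subst (F oo G) f) n = mfps_nth (mfps_subst F (mfps_subst G f)) n" for n
  proof -
    define N where "N = total_degree n"
    have "mfps_nth (mfps_subst (F oo G) f) n =
        (\<Sum>k\<le>N. \<Sum>i\<le>k. fps_nth F i * fps_nth (G ^ i) k * mfps_nth (f ^ k) n)"
      by (simp add: mfps_subst_def N_def [symmetric] fps_compose_nth sum_distrib_right
          atLeast0AtMost)
    also have "\<dots> = (\<Sum>k\<le>N. \<Sum>i\<le>N. fps_nth F i * fps_nth (G ^ i) k * mfps_nth (f ^ k) n)"
      using G by (intro sum.cong refl sum.mono_neutral_left)
        (auto simp: startsby_zero_power_prefix)
    also have "\<dots> = (\<Sum>i\<le>N. \<Sum>k\<le>N. fps_nth F i * fps_nth (G ^ i) k * mfps_nth (f ^ k) n)"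
      by (rule sum.swap)
    also have "\<dots> = (\<Sum>i\<le>N. fps_nth F i * mfps_nth (mfps_subst (G ^ i) f) n)"
      by (simp add: mfps_subst_def N_def [symmetric] sum_distrib_left mult.assoc)
    also have "\<dots> = mfps_nth (mfps_subst F (mfps_subst G f)) n"
      by (simp add: mfps_subst_power [OF f]) (simp add: mfps_subst_def N_def)
    finally show ?thesis .
  qed
  then show ?thesis
    by (simp add: mfps_eq_iff)
qed


section \<open>Powers with an exponent from the field\<close>

lemma fps_exp_of_nat_compose_ln:
  "fps_exp 1 oo (fps_const (of_nat k) * fps_ln 1) = (1 + fps_X :: 'a::field_char_0 fps) ^ k"
proof -
  let ?ln = "fps_ln 1 :: 'a fps"
  have "fps_exp 1 - 1 oo ?ln = fps_X"
    using fps_inv_fps_exp_compose(2) [of "1 :: 'a"] by (simp add: fps_ln_fps_exp_inv)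
  then have exp_ln: "fps_exp 1 oo ?ln = 1 + fps_X"
    by (simp add: fps_compose_sub_distrib algebra_simps)
  have "fps_const (of_nat k) * ?ln = (fps_const (of_nat k) * fps_X) oo ?ln"
    by (simp add: fps_compose_mult_distrib)
  then have "fps_exp 1 oo (fps_const (of_nat k) * ?ln) =
      (fps_exp 1 oo (fps_const (of_nat k) * fps_X)) oo ?ln"
    by (simp only: fps_compose_assoc [of ?ln "fps_const (of_nat k) * fps_X"] fps_ln_0
        fps_mult_nth_0 fps_X_nth mult_zero_right refl one_neq_zero [symmetric] if_False)
  also have "\<dots> = (fps_exp 1 ^ k) oo ?ln"
    by (simp add: fps_exp_power_mult)
  also have "\<dots> = (1 + fps_X) ^ k"
    by (simp add: fps_compose_power [symmetric] exp_ln)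
  finally show ?thesis .
qed

lemma mfps_powr_of_nat:
  fixes f :: "('i::finite, 'a::field_char_0) mfps"
  assumes "mfps_nth f 0 = 1"
  shows "mfps_powr f (of_nat k) = f ^ k"
proof -
  have f: "mfps_nth (f - 1) 0 = 0"
    using assms by (simp add: mfps_nth_one)
  have "mfps_powr f (of_nat k) =
      mfps_subst (fps_exp 1 oo (fps_const (of_nat k) * fps_ln 1)) (f - 1)"
    unfolding mfps_powr_def mfps_exp_def mfps_ln_def
    by (subst mfps_subst_compose [OF f]) (simp_all add: fps_ln_def mfps_subst_const_mult)
  also have "\<dots> = f ^ k"
    by (simp add: fps_exp_of_nat_compose_ln mfps_subst_power [OF f] mfps_subst_add
        mfps_subst_X [OF f])
  finally show ?thesis .
qed

text \<open>The coefficients of a power are polynomial functions of the exponent.\<close>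
lemma mfps_nth_powr_eq_poly:
  fixes f :: "('i::finite, 'a::field_char_0) mfps"
  shows "\<exists>p. \<forall>c. mfps_nth (mfps_powr f c) n = poly p c"
proof (intro exI allI)
  fix c
  show "mfps_nth (mfps_powr f c) n =
      poly (\<Sum>k\<le>total_degree n. monom (mfps_nth (mfps_ln f ^ k) n / fact k) k) c"
    by (simp add: mfps_powr_def mfps_exp_def mfps_subst_def mfps_nth_const_mult_power
        poly_sum poly_monom mult_ac)
qed


section \<open>Colourings of a multigraph\<close>

text \<open>The edges all of whose ends receive the same colour; every loop is one of them.\<close>
definition monochromatic_edges :: "('v, 'e) multigraph \<Rightarrow> ('v \<Rightarrow> nat) \<Rightarrow> 'e set" where
  "monochromatic_edges \<Gamma> \<sigma> =
    {e \<in> edges \<Gamma>. \<forall>u\<in>ends \<Gamma> e. \<forall>w\<in>ends \<Gamma> e. \<sigma> u = \<sigma> w}"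

lemma equiv_connectivity: "equiv (verts \<Gamma>) (connectivity \<Gamma> A)"
proof (rule equivI)
  have "sym ((adjacency \<Gamma> A)\<^sup>*)"
    by (intro sym_rtrancl symI) (auto simp: adjacency_def insert_commute)
  then show "sym (connectivity \<Gamma> A)"
    by (auto simp: connectivity_def sym_def)
qed (auto simp: connectivity_def refl_on_def trans_def)

lemma colour_eq_if_connected:
  assumes "A \<subseteq> monochromatic_edges \<Gamma> \<sigma>" "(u, w) \<in> connectivity \<Gamma> A"
  shows "\<sigma> u = \<sigma> w"
proof -
  have "(u, w) \<in> (adjacency \<Gamma> A)\<^sup>*"
    using assms(2) by (simp add: connectivity_def)
  then show ?thesis
  proof induction
    case (step w z)
    then obtain e where "e \<in> A" "ends \<Gamma> e = {w, z}"
      by (auto simp: adjacency_def)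
    then have "\<sigma> w = \<sigma> z"
      using assms(1) unfolding monochromatic_edges_def by blast
    then show ?case
      using step.IH by simp
  qed simp
qed

locale finite_multigraph =
  fixes \<Gamma> :: "('v, 'e) multigraph"
  assumes finite_verts [simp]: "finite (verts \<Gamma>)"
    and finite_edges [simp]: "finite (edges \<Gamma>)"
    and ends_verts: "e \<in> edges \<Gamma> \<Longrightarrow> \<exists>u\<in>verts \<Gamma>. \<exists>w\<in>verts \<Gamma>. ends \<Gamma> e = {u, w}"
begin

lemma finite_monochromatic_edges [simp]: "finite (monochromatic_edges \<Gamma> \<sigma>)"
  by (simp add: monochromatic_edges_def)

lemma finite_colourings [simp]: "finite (verts \<Gamma> \<rightarrow>\<^sub>E {..<k::nat})"
  by (intro finite_PiE) auto

text \<open>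
  A colouring for which all edges in \<open>A\<close> are monochromatic is an arbitrary choice of a colour
  for each component of the spanning subgraph with edge set \<open>A\<close>.
\<close>
lemma card_colourings_monochromatic:
  assumes A: "A \<subseteq> edges \<Gamma>"
  shows "card {\<sigma> \<in> verts \<Gamma> \<rightarrow>\<^sub>E {..<k}. A \<subseteq> monochromatic_edges \<Gamma> \<sigma>} = k ^ num_components \<Gamma> A"
    (is "card ?S = _")
proof -
  let ?V = "verts \<Gamma>" and ?R = "connectivity \<Gamma> A"
  let ?C = "?V // ?R"
  define g where "g \<tau> = (\<lambda>v\<in>?V. \<tau> (?R `` {v}))" for \<tau> :: "'v set \<Rightarrow> nat"
  note equiv = equiv_connectivity [of \<Gamma> A]
  have "bij_betw g (?C \<rightarrow>\<^sub>E {..<k}) ?S"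
    unfolding bij_betw_def
  proof
    show "inj_on g (?C \<rightarrow>\<^sub>E {..<k})"
    proof (rule inj_onI)
      fix \<tau> \<tau>' assume *: "\<tau> \<in> ?C \<rightarrow>\<^sub>E {..<k}" "\<tau>' \<in> ?C \<rightarrow>\<^sub>E {..<k}" "g \<tau> = g \<tau>'"
      show "\<tau> = \<tau>'"
      proof (rule PiE_ext [OF *(1,2)])
        fix c assume "c \<in> ?C"
        then obtain v where v: "v \<in> ?V" "c = ?R `` {v}"
          by (auto elim: quotientE)
        then show "\<tau> c = \<tau>' c"
          using fun_cong [OF *(3), of v] by (simp add: g_def)
      qed
    qed
    show "g ` (?C \<rightarrow>\<^sub>E {..<k}) = ?S"
    proof (intro equalityI subsetI)
      fix \<sigma> assume "\<sigma> \<in> g ` (?C \<rightarrow>\<^sub>E {..<k})"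
      then obtain \<tau> where \<tau>: "\<tau> \<in> ?C \<rightarrow>\<^sub>E {..<k}" and \<sigma>: "\<sigma> = g \<tau>"
        by auto
      have "\<sigma> \<in> ?V \<rightarrow>\<^sub>E {..<k}"
        using \<tau> by (auto simp: \<sigma> g_def quotientI intro!: PiE_mem [OF \<tau>, simplified])
      moreover have "e \<in> monochromatic_edges \<Gamma> \<sigma>" if e: "e \<in> A" for e
      proof -
        obtain u w where uw: "u \<in> ?V" "w \<in> ?V" "ends \<Gamma> e = {u, w}"
          using e A ends_verts by blast
        then have "(u, w) \<in> ?R"
          using e by (auto simp: connectivity_def adjacency_def)
        then have "?R `` {u} = ?R `` {w}"
          using equiv_class_eq [OF equiv] by blast
        then show ?thesis
          using uw e A by (auto simp: monochromatic_edges_def \<sigma> g_def)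
      qed
      ultimately show "\<sigma> \<in> ?S"
        by auto
    next
      fix \<sigma> assume \<sigma>: "\<sigma> \<in> ?S"
      define \<tau> where "\<tau> = (\<lambda>c\<in>?C. \<sigma> (SOME v. v \<in> c))"
      have \<tau>_class: "\<tau> (?R `` {v}) = \<sigma> v" if v: "v \<in> ?V" for v
      proof -
        have "v \<in> ?R `` {v}"
          using equiv_class_self [OF equiv v] .
        then have "(SOME w. w \<in> ?R `` {v}) \<in> ?R `` {v}"
          by (rule someI)
        then have "\<sigma> v = \<sigma> (SOME w. w \<in> ?R `` {v})"
          using \<sigma> by (intro colour_eq_if_connected [of A]) auto
        then show ?thesis
          using v by (simp add: \<tau>_def quotientI)
      qed
      have "\<tau> c \<in> {..<k}" if "c \<in> ?C" for c
        using that
      proof (rule quotientE)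
        fix v assume "c = ?R `` {v}" "v \<in> ?V"
        then show ?thesis
          using \<tau>_class [of v] PiE_mem [of \<sigma> ?V "\<lambda>_. {..<k}" v] \<sigma> by simp
      qed
      then have \<tau>: "\<tau> \<in> ?C \<rightarrow>\<^sub>E {..<k}"
        by (auto simp: \<tau>_def)
      have \<sigma>_eq: "\<sigma> = g \<tau>"
      proof
        fix v show "\<sigma> v = g \<tau> v"
          using \<sigma> PiE_arb [of \<sigma> ?V "\<lambda>_. {..<k}" v]
          by (cases "v \<in> ?V") (simp_all add: g_def \<tau>_class)
      qed
      show "\<sigma> \<in> g ` (?C \<rightarrow>\<^sub>E {..<k})"
        unfolding \<sigma>_eq using \<tau> by (rule imageI)
    qed
  qed
  then have "card ?S = card (?C \<rightarrow>\<^sub>E {..<k})"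
    by (simp add: bij_betw_same_card)
  also have "\<dots> = k ^ num_components \<Gamma> A"
    using equiv by (simp add: card_PiE finite_quotient num_components_def equiv_def)
  finally show ?thesis .
qed

lemma num_components_antimono:
  assumes "A \<subseteq> B" "B \<subseteq> edges \<Gamma>"
  shows "num_components \<Gamma> B \<le> num_components \<Gamma> A"
proof -
  have "card {\<sigma> \<in> verts \<Gamma> \<rightarrow>\<^sub>E {..<2}. B \<subseteq> monochromatic_edges \<Gamma> \<sigma>} \<le>
      card {\<sigma> \<in> verts \<Gamma> \<rightarrow>\<^sub>E {..<2}. A \<subseteq> monochromatic_edges \<Gamma> \<sigma>}"
    using assms by (intro card_mono) auto
  then have "(2::nat) ^ num_components \<Gamma> B \<le> 2 ^ num_components \<Gamma> A"
    using assms by (simp add: card_colourings_monochromatic)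
  then show ?thesis
    by simp
qed

text \<open>
  Classify the \<open>2\<^sup>|\<^sup>V\<^sup>|\<close> colourings with two colours by the set \<open>B\<close> of monochromatic edges in \<open>A\<close>.
  There are at most \<open>2\<^sup>|\<^sup>A\<^sup>|\<close> classes, and comparing the colourings in one class with a fixed
  member of it gives an injection into the colourings for which all of \<open>A\<close> is monochromatic.
\<close>
lemma card_verts_le:
  assumes A: "A \<subseteq> edges \<Gamma>"
  shows "card (verts \<Gamma>) \<le> num_components \<Gamma> A + card A"
proof -
  let ?V = "verts \<Gamma>"
  let ?K = "?V \<rightarrow>\<^sub>E {..<2::nat}"
  let ?S = "{\<sigma> \<in> ?K. A \<subseteq> monochromatic_edges \<Gamma> \<sigma>}"
  define F where "F B = {\<sigma> \<in> ?K. A \<inter> monochromatic_edges \<Gamma> \<sigma> = B}" for B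
  have fin: "finite A"
    using A finite_edges by (rule finite_subset)
  have "card (F B) \<le> card ?S" for B
  proof (cases "F B = {}")
    case False
    then obtain \<tau> where \<tau>: "\<tau> \<in> F B"
      by auto
    define g where "g \<sigma> = (\<lambda>v\<in>?V. if \<sigma> v = \<tau> v then 0 else (1::nat))" for \<sigma>
    have "inj_on g (F B)"
    proof (rule inj_onI)
      fix \<sigma> \<sigma>' assume *: "\<sigma> \<in> F B" "\<sigma>' \<in> F B" "g \<sigma> = g \<sigma>'"
      have K: "\<sigma> \<in> ?K" "\<sigma>' \<in> ?K" "\<tau> \<in> ?K"
        using * \<tau> by (auto simp: F_def)
      show "\<sigma> = \<sigma>'"
      proof (rule PiE_ext [OF K(1,2)])
        fix v assume v: "v \<in> ?V"
        have "\<sigma> v < 2" "\<sigma>' v < 2" "\<tau> v < 2"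
          using K v by auto
        then show "\<sigma> v = \<sigma>' v"
          using fun_cong [OF *(3), of v] v by (auto simp: g_def split: if_splits)
      qed
    qed
    moreover have "g ` F B \<subseteq> ?S"
    proof
      fix \<sigma>' assume "\<sigma>' \<in> g ` F B"
      then obtain \<sigma> where \<sigma>: "\<sigma> \<in> F B" and \<sigma>': "\<sigma>' = g \<sigma>"
        by auto
      have "e \<in> monochromatic_edges \<Gamma> \<sigma>'" if e: "e \<in> A" for e
      proof -
        obtain u w where uw: "u \<in> ?V" "w \<in> ?V" "ends \<Gamma> e = {u, w}"
          using e A ends_verts by blast
        have "\<sigma> u < 2" "\<sigma> w < 2" "\<tau> u < 2" "\<tau> w < 2"
          using \<sigma> \<tau> uw by (auto simp: F_def)
        moreover have "e \<in> monochromatic_edges \<Gamma> \<sigma> \<longleftrightarrow> e \<in> monochromatic_edges \<Gamma> \<tau>"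
          using \<sigma> \<tau> e by (auto simp: F_def)
        then have "\<sigma> u = \<sigma> w \<longleftrightarrow> \<tau> u = \<tau> w"
          using uw e A by (auto simp: monochromatic_edges_def)
        ultimately show ?thesis
          using uw e A by (auto simp: monochromatic_edges_def \<sigma>' g_def)
      qed
      then show "\<sigma>' \<in> ?S"
        by (auto simp: \<sigma>' g_def)
    qed
    ultimately show ?thesis
      by (intro card_inj_on_le) auto
  qed simp
  then have le: "card (F B) \<le> 2 ^ num_components \<Gamma> A" for B
    by (simp add: card_colourings_monochromatic [OF A])
  have "?K = (\<Union>B\<in>Pow A. F B)"
    by (auto simp: F_def)
  then have "2 ^ card ?V = card (\<Union>B\<in>Pow A. F B)"
    using card_PiE [OF finite_verts, of "\<lambda>_. {..<2::nat}"] by simp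
  also have "\<dots> \<le> (\<Sum>B\<in>Pow A. card (F B))"
    using fin by (intro card_UN_le) auto
  also have "\<dots> \<le> (\<Sum>B\<in>Pow A. 2 ^ num_components \<Gamma> A)"
    by (intro sum_mono le)
  also have "\<dots> = 2 ^ (num_components \<Gamma> A + card A)"
    using fin by (simp add: card_Pow power_add)
  finally show ?thesis
    by simp
qed

text \<open>The Tutte polynomial as the Fortuin--Kasteleyn sum with \<open>q = (x - 1) (y - 1)\<close>.\<close>
lemma Tutte_eq_sum_num_components:
  fixes x y :: "'a::field"
  assumes "y \<noteq> 1"
  shows "(x - 1) ^ num_components \<Gamma> (edges \<Gamma>) * Tutte \<Gamma> x y =
    (\<Sum>A\<in>Pow (edges \<Gamma>). ((x - 1) * (y - 1)) ^ num_components \<Gamma> A * (y - 1) ^ card A) /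
      (y - 1) ^ card (verts \<Gamma>)"
proof -
  have "(x - 1) ^ num_components \<Gamma> (edges \<Gamma>) *
      ((x - 1) ^ (num_components \<Gamma> A - num_components \<Gamma> (edges \<Gamma>)) *
       (y - 1) ^ (num_components \<Gamma> A + card A - card (verts \<Gamma>))) =
      ((x - 1) * (y - 1)) ^ num_components \<Gamma> A * (y - 1) ^ card A / (y - 1) ^ card (verts \<Gamma>)"
    if "A \<in> Pow (edges \<Gamma>)" for A
  proof -
    have A: "A \<subseteq> edges \<Gamma>"
      using that by simp
    have "(y - 1) ^ (num_components \<Gamma> A + card A - card (verts \<Gamma>)) =
        (y - 1) ^ (num_components \<Gamma> A + card A) / (y - 1) ^ card (verts \<Gamma>)"
      using assms by (intro power_diff card_verts_le A) simp
    moreover have "(x - 1) ^ num_components \<Gamma> (edges \<Gamma>) *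
        (x - 1) ^ (num_components \<Gamma> A - num_components \<Gamma> (edges \<Gamma>)) =
        (x - 1) ^ num_components \<Gamma> A"
      using num_components_antimono [OF A] by (simp flip: power_add)
    ultimately show ?thesis
      by (simp add: power_add power_mult_distrib mult_ac)
  qed
  then show ?thesis
    by (simp add: Tutte_def sum_distrib_left sum_divide_distrib)
qed

text \<open>
  For a natural number \<open>q = k\<close> the same sum is the partition function of the Potts model
  with \<open>k\<close> colours.
\<close>
lemma sum_num_components_eq_sum_colourings:
  fixes y :: "'a::comm_ring_1"
  shows "(\<Sum>A\<in>Pow (edges \<Gamma>). of_nat k ^ num_components \<Gamma> A * (y - 1) ^ card A) =
    (\<Sum>\<sigma>\<in>verts \<Gamma> \<rightarrow>\<^sub>E {..<k}. y ^ card (monochromatic_edges \<Gamma> \<sigma>))"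
proof -
  let ?K = "verts \<Gamma> \<rightarrow>\<^sub>E {..<k}"
  have "(\<Sum>A\<in>Pow (edges \<Gamma>). of_nat k ^ num_components \<Gamma> A * (y - 1) ^ card A) =
      (\<Sum>A\<in>Pow (edges \<Gamma>). \<Sum>\<sigma>\<in>{\<sigma> \<in> ?K. A \<subseteq> monochromatic_edges \<Gamma> \<sigma>}. (y - 1) ^ card A)"
    by (intro sum.cong refl)
      (simp add: card_colourings_monochromatic flip: of_nat_power)
  also have "\<dots> = (\<Sum>\<sigma>\<in>?K. \<Sum>A\<in>{A \<in> Pow (edges \<Gamma>). A \<subseteq> monochromatic_edges \<Gamma> \<sigma>}. (y - 1) ^ card A)"
    by (rule sum.swap_restrict) auto
  also have "\<dots> = (\<Sum>\<sigma>\<in>?K. \<Sum>A\<in>Pow (monochromatic_edges \<Gamma> \<sigma>). (y - 1) ^ card A)"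
  proof (rule sum.cong [OF refl])
    fix \<sigma>
    have "{A \<in> Pow (edges \<Gamma>). A \<subseteq> monochromatic_edges \<Gamma> \<sigma>} = Pow (monochromatic_edges \<Gamma> \<sigma>)"
      unfolding monochromatic_edges_def by blast
    then show "(\<Sum>A\<in>{A \<in> Pow (edges \<Gamma>). A \<subseteq> monochromatic_edges \<Gamma> \<sigma>}. (y - 1) ^ card A) =
        (\<Sum>A\<in>Pow (monochromatic_edges \<Gamma> \<sigma>). (y - 1) ^ card A)"
      by simp
  qed
  also have "\<dots> = (\<Sum>\<sigma>\<in>?K. y ^ card (monochromatic_edges \<Gamma> \<sigma>))"
  proof (rule sum.cong [OF refl])
    fix \<sigma>
    show "(\<Sum>A\<in>Pow (monochromatic_edges \<Gamma> \<sigma>). (y - 1) ^ card A) =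
        y ^ card (monochromatic_edges \<Gamma> \<sigma>)"
      using prod_add [of "monochromatic_edges \<Gamma> \<sigma>" "\<lambda>_. y - 1" "\<lambda>_. 1"] by simp
  qed
  finally show ?thesis .
qed

end


section \<open>Colourings of weighted complete multipartite graphs\<close>

text \<open>
  The edges of the weighted complete multipartite graph on an arbitrary vertex set \<open>W\<close> of pairs;
  the first component of a vertex is the index of its part.
\<close>
definition multipartite_edges ::
  "('i::linorder \<Rightarrow> 'i \<Rightarrow> nat) \<Rightarrow> ('i \<times> nat) set \<Rightarrow> (('i \<times> nat) \<times> ('i \<times> nat) \<times> nat) set" where
  "multipartite_edges l W =
    {(\<alpha>, \<beta>, c). \<alpha> \<in> W \<and> \<beta> \<in> W \<and> fst \<alpha> < fst \<beta> \<and> c < l (fst \<alpha>) (fst \<beta>)}"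

text \<open>The vertices of \<open>W\<close> that lie in the part with index \<open>i\<close>.\<close>
definition part :: "('i \<times> nat) set \<Rightarrow> 'i \<Rightarrow> ('i \<times> nat) set" where
  "part W i = {v \<in> W. fst v = i}"

text \<open>The exponent vector that records the sizes of the parts.\<close>
definition part_sizes :: "('i \<times> nat) set \<Rightarrow> 'i \<Rightarrow> nat" where
  "part_sizes W i = card (part W i)"

lemma finite_part [simp]: "finite W \<Longrightarrow> finite (part W i)"
  by (simp add: part_def)

lemma part_sizes_mono:
  assumes "finite V" "W \<subseteq> V"
  shows "part_sizes W \<le> part_sizes V"
  using assms by (auto simp: le_fun_def part_sizes_def part_def intro!: card_mono)

lemma part_sizes_Diff:
  assumes "finite V" "W \<subseteq> V"
  shows "part_sizes (V - W) = part_sizes V - part_sizes W"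
proof
  fix i
  have "part (V - W) i = part V i - part W i" "part W i \<subseteq> part V i"
    using assms(2) by (auto simp: part_def)
  then show "part_sizes (V - W) i = (part_sizes V - part_sizes W) i"
    using assms by (simp add: part_sizes_def card_Diff_subset finite_subset)
qed

lemma multipartite_edges_eq_UN:
  "multipartite_edges l W =
    (\<Union>(i, j)\<in>{(i, j). i < j}. part W i \<times> part W j \<times> {..<l i j})"
  by (auto simp: multipartite_edges_def part_def)

lemma finite_multipartite_edges [simp]:
  fixes W :: "('i::{finite, linorder} \<times> nat) set"
  shows "finite W \<Longrightarrow> finite (multipartite_edges l W)"
  by (auto simp: multipartite_edges_eq_UN)

lemma card_multipartite_edges:
  fixes W :: "('i::{finite, linorder} \<times> nat) set"
  assumes "finite W"
  shows "card (multipartite_edges l W) =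
    (\<Sum>(i, j)\<in>{(i, j). i < j}. l i j * part_sizes W i * part_sizes W j)"
proof -
  have "card (multipartite_edges l W) =
      (\<Sum>p\<in>{(i, j). i < j}. card (case p of (i, j) \<Rightarrow> part W i \<times> part W j \<times> {..<l i j}))"
    unfolding multipartite_edges_eq_UN
  proof (rule card_UN_disjoint)
    show "\<forall>p\<in>{(i, j). i < j}. finite (case p of (i, j) \<Rightarrow> part W i \<times> part W j \<times> {..<l i j})"
      using assms by auto
  qed (auto simp: part_def)
  then show ?thesis
    by (simp add: case_prod_beta card_cartesian_product part_sizes_def mult_ac)
qed

lemma card_subsets_part_sizes:
  fixes V :: "('i::finite \<times> nat) set"
  assumes "finite V"
  shows "card {W \<in> Pow V. part_sizes W = m} = (\<Prod>i\<in>UNIV. part_sizes V i choose m i)"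
proof -
  let ?B = "\<lambda>i. {B. B \<subseteq> part V i \<and> card B = m i}"
  have part_UN: "part (\<Union>j. B j) i = B i" if "\<And>j. B j \<subseteq> part V j" for B i
    using that by (fastforce simp: part_def)
  have "bij_betw part {W \<in> Pow V. part_sizes W = m} (PiE UNIV ?B)"
  proof (rule bij_betw_byWitness [where f' = "\<lambda>B. \<Union>i. B i"])
    show "\<forall>W\<in>{W \<in> Pow V. part_sizes W = m}. (\<Union>i. part W i) = W"
      by (auto simp: part_def)
    show "\<forall>B\<in>PiE UNIV ?B. part (\<Union>i. B i) = B"
      by (auto simp: PiE_iff fun_eq_iff part_UN)
    show "part ` {W \<in> Pow V. part_sizes W = m} \<subseteq> PiE UNIV ?B"
      by (auto simp: part_sizes_def part_def)
    have "(\<Union>i. B i) \<subseteq> V" "part_sizes (\<Union>i. B i) = m" if "B \<in> PiE UNIV ?B" for B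
    proof -
      have B: "B i \<subseteq> part V i" "card (B i) = m i" for i
        using that by (auto simp: PiE_iff)
      then show "(\<Union>i. B i) \<subseteq> V"
        by (force simp: part_def)
      show "part_sizes (\<Union>i. B i) = m"
        using B by (simp add: fun_eq_iff part_sizes_def part_UN)
    qed
    then show "(\<lambda>B. \<Union>i. B i) ` PiE UNIV ?B \<subseteq> {W \<in> Pow V. part_sizes W = m}"
      by blast
  qed
  then have "card {W \<in> Pow V. part_sizes W = m} = card (PiE UNIV ?B)"
    by (rule bij_betw_same_card)
  also have "\<dots> = (\<Prod>i\<in>UNIV. part_sizes V i choose m i)"
    using assms by (simp add: card_PiE n_subsets part_sizes_def)
  finally show ?thesis .
qed

lemma sum_Pow_part_sizes:
  fixes V :: "('i::finite \<times> nat) set" and \<phi> :: "('i \<Rightarrow> nat) \<Rightarrow> 'a::comm_semiring_1"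
  assumes "finite V"
  shows "(\<Sum>W\<in>Pow V. \<phi> (part_sizes W)) =
    (\<Sum>m\<le>part_sizes V. of_nat (\<Prod>i\<in>UNIV. part_sizes V i choose m i) * \<phi> m)"
proof -
  have "(\<Sum>W\<in>Pow V. \<phi> (part_sizes W)) =
      (\<Sum>m\<le>part_sizes V. \<Sum>W\<in>{W \<in> Pow V. part_sizes W = m}. \<phi> (part_sizes W))"
    using assms by (intro sum.group [symmetric]) (auto simp: part_sizes_mono)
  also have "\<dots> = (\<Sum>m\<le>part_sizes V. of_nat (\<Prod>i\<in>UNIV. part_sizes V i choose m i) * \<phi> m)"
    using assms by (intro sum.cong refl) (simp flip: card_subsets_part_sizes)
  finally show ?thesis .
qed

lemma total_degree_Diff:
  assumes "m \<le> n"
  shows "total_degree n = total_degree m + total_degree (n - m)"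
  using assms by (simp add: total_degree_def le_fun_def flip: sum.distrib)

lemma exponent_fact_choose:
  assumes "m \<le> n"
  shows "exponent_fact n =
    (\<Prod>i\<in>UNIV. n i choose m i) * exponent_fact m * exponent_fact (n - m)"
proof -
  have "fact (n i) = (n i choose m i) * fact (m i) * fact (n i - m i)" for i
    using binomial_fact_lemma [of "m i" "n i"] assms by (simp add: le_fun_def mult_ac)
  then show ?thesis
    by (simp add: exponent_fact_def flip: prod.distrib)
qed

text \<open>The edges of the weighted multipartite graph on \<open>V\<close> that are monochromatic for \<open>\<sigma>\<close>.\<close>
definition multipartite_monochromatic ::
  "('i::linorder \<Rightarrow> 'i \<Rightarrow> nat) \<Rightarrow> ('i \<times> nat) set \<Rightarrow> ('i \<times> nat \<Rightarrow> nat) \<Rightarrow>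
    (('i \<times> nat) \<times> ('i \<times> nat) \<times> nat) set" where
  "multipartite_monochromatic l V \<sigma> = {(\<alpha>, \<beta>, c) \<in> multipartite_edges l V. \<sigma> \<alpha> = \<sigma> \<beta>}"

text \<open>The class \<open>W\<close> of the last colour splits off, together with all edges inside \<open>W\<close>.\<close>
lemma sum_colourings_Suc:
  fixes V :: "('i::{finite, linorder} \<times> nat) set" and y :: "'a::comm_semiring_1"
  assumes "finite V"
  shows "(\<Sum>\<sigma>\<in>V \<rightarrow>\<^sub>E {..<Suc k}. y ^ card (multipartite_monochromatic l V \<sigma>)) =
    (\<Sum>W\<in>Pow V. y ^ card (multipartite_edges l W) *
      (\<Sum>\<tau>\<in>(V - W) \<rightarrow>\<^sub>E {..<k}. y ^ card (multipartite_monochromatic l (V - W) \<tau>)))"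
proof -
  let ?M = "multipartite_monochromatic l"
  let ?S = "SIGMA W:Pow V. (V - W) \<rightarrow>\<^sub>E {..<k}"
  \<comment> \<open>The colours are \<open>0, \<dots>, k\<close>, so \<open>k\<close> is the last one; \<open>\<tau>\<close> is \<open>undefined\<close> outside \<open>V - W\<close>.\<close>
  define join :: "('i \<times> nat) set \<times> ('i \<times> nat \<Rightarrow> nat) \<Rightarrow> 'i \<times> nat \<Rightarrow> nat"
    where "join = (\<lambda>(W, \<tau>) v. if v \<in> W then k else \<tau> v)"
  define split where "split \<sigma> = ({v \<in> V. \<sigma> v = k}, restrict \<sigma> (V - {v \<in> V. \<sigma> v = k}))"
    for \<sigma> :: "'i \<times> nat \<Rightarrow> nat"
  have join_split: "join (split \<sigma>) = \<sigma>" if "\<sigma> \<in> V \<rightarrow>\<^sub>E {..<Suc k}" for \<sigma>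
  proof
    fix v show "join (split \<sigma>) v = \<sigma> v"
      using PiE_arb [OF that, of v] by (cases "v \<in> V") (simp_all add: join_def split_def)
  qed
  have split_in: "split \<sigma> \<in> ?S" if "\<sigma> \<in> V \<rightarrow>\<^sub>E {..<Suc k}" for \<sigma>
  proof -
    have "\<sigma> v < k" if "v \<in> V" "\<sigma> v \<noteq> k" for v
      using PiE_mem [OF \<open>\<sigma> \<in> V \<rightarrow>\<^sub>E {..<Suc k}\<close> \<open>v \<in> V\<close>] that by simp
    then show ?thesis
      by (simp add: split_def)
  qed
  have join_in: "join (W, \<tau>) \<in> V \<rightarrow>\<^sub>E {..<Suc k}" if "(W, \<tau>) \<in> ?S" for W \<tau>
  proof (rule PiE_I)
    from that have W: "W \<subseteq> V" and \<tau>: "\<tau> \<in> (V - W) \<rightarrow>\<^sub>E {..<k}"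
      by auto
    fix v
    show "join (W, \<tau>) v \<in> {..<Suc k}" if "v \<in> V"
      using that PiE_mem [OF \<tau>, of v] by (auto simp: join_def less_Suc_eq)
    show "join (W, \<tau>) v = undefined" if "v \<notin> V"
      using that W PiE_arb [OF \<tau>, of v] by (auto simp: join_def)
  qed
  have split_join: "split (join (W, \<tau>)) = (W, \<tau>)" if "(W, \<tau>) \<in> ?S" for W \<tau>
  proof -
    from that have W: "W \<subseteq> V" and \<tau>: "\<tau> \<in> (V - W) \<rightarrow>\<^sub>E {..<k}"
      by auto
    have eq: "{v \<in> V. join (W, \<tau>) v = k} = W"
    proof -
      have "\<tau> v \<noteq> k" if "v \<in> V" "v \<notin> W" for v
        using PiE_mem [OF \<tau>, of v] that by simp
      then show ?thesis
        using W by (auto simp: join_def)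
    qed
    have "restrict (join (W, \<tau>)) (V - W) v = \<tau> v" for v
      using PiE_arb [OF \<tau>, of v] by (cases "v \<in> V - W") (auto simp: join_def)
    then show ?thesis
      by (auto simp: split_def eq)
  qed
  have card: "card (?M V (join (W, \<tau>))) = card (multipartite_edges l W) + card (?M (V - W) \<tau>)"
    if "(W, \<tau>) \<in> ?S" for W \<tau>
  proof -
    from that have W: "W \<subseteq> V" and \<tau>: "\<tau> \<in> (V - W) \<rightarrow>\<^sub>E {..<k}"
      by auto
    have ne: "\<tau> v \<noteq> k" if "v \<in> V" "v \<notin> W" for v
      using PiE_mem [OF \<tau>, of v] that by simp
    have "join (W, \<tau>) \<alpha> = join (W, \<tau>) \<beta> \<longleftrightarrow>
        \<alpha> \<in> W \<and> \<beta> \<in> W \<or> \<alpha> \<notin> W \<and> \<beta> \<notin> W \<and> \<tau> \<alpha> = \<tau> \<beta>" if "\<alpha> \<in> V" "\<beta> \<in> V" for \<alpha> \<beta>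
      using ne [OF that(1)] ne [OF that(2)] by (auto simp: join_def)
    then have "?M V (join (W, \<tau>)) = multipartite_edges l W \<union> ?M (V - W) \<tau>"
      using subsetD [OF W] unfolding multipartite_monochromatic_def multipartite_edges_def by auto
    moreover have "multipartite_edges l W \<inter> ?M (V - W) \<tau> = {}"
      by (auto simp: multipartite_monochromatic_def multipartite_edges_def)
    moreover have "?M (V - W) \<tau> \<subseteq> multipartite_edges l (V - W)"
      by (auto simp: multipartite_monochromatic_def)
    then have "finite (?M (V - W) \<tau>)"
      by (rule finite_subset) (simp add: assms)
    ultimately show ?thesis
      using W assms by (simp add: card_Un_disjoint finite_subset)
  qed
  have "(\<Sum>\<sigma>\<in>V \<rightarrow>\<^sub>E {..<Suc k}. y ^ card (?M V \<sigma>)) =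
      (\<Sum>(W, \<tau>)\<in>?S. y ^ card (multipartite_edges l W) * y ^ card (?M (V - W) \<tau>))"
  proof (rule sum.reindex_bij_witness [where i = join and j = split])
    show "split (join p) = p" "join p \<in> V \<rightarrow>\<^sub>E {..<Suc k}" if "p \<in> ?S" for p
      using split_join [of "fst p" "snd p"] join_in [of "fst p" "snd p"] that
      by (simp_all only: prod.collapse)
    fix \<sigma> assume \<sigma>: "\<sigma> \<in> V \<rightarrow>\<^sub>E {..<Suc k}"
    show "join (split \<sigma>) = \<sigma>" "split \<sigma> \<in> ?S"
      using join_split [OF \<sigma>] split_in [OF \<sigma>] by simp_all
    obtain W \<tau> where W\<tau>: "split \<sigma> = (W, \<tau>)"
      by fastforce
    then have "card (?M V \<sigma>) = card (multipartite_edges l W) + card (?M (V - W) \<tau>)"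
      using card [of W \<tau>] split_in [OF \<sigma>] join_split [OF \<sigma>] by simp
    then show "(case split \<sigma> of (W, \<tau>) \<Rightarrow>
        y ^ card (multipartite_edges l W) * y ^ card (?M (V - W) \<tau>)) = y ^ card (?M V \<sigma>)"
      by (simp add: W\<tau> power_add)
  qed
  also have "\<dots> = (\<Sum>W\<in>Pow V. \<Sum>\<tau>\<in>(V - W) \<rightarrow>\<^sub>E {..<k}.
      y ^ card (multipartite_edges l W) * y ^ card (?M (V - W) \<tau>))"
    using assms by (intro sum.Sigma [symmetric]) (auto intro: finite_PiE)
  finally show ?thesis
    by (simp add: sum_distrib_left)
qed

section \<open>The generating function of the colourings\<close>

text \<open>
  The exponential generating function of \<open>y\<^bsup>e(m)\<^esup> / (y - 1)\<^bsup>|m|\<^esup>\<close>, where \<open>e(m)\<close> is the number of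
  edges of the weighted multipartite graph with part sizes \<open>m\<close>.
\<close>
definition edge_series ::
  "('i::{finite, linorder} \<Rightarrow> 'i \<Rightarrow> nat) \<Rightarrow> 'a::field_char_0 \<Rightarrow> ('i, 'a) mfps" where
  "edge_series l y = Abs_mfps (\<lambda>m.
    y ^ (\<Sum>(i, j)\<in>{(i, j). i < j}. l i j * m i * m j) *
    (y - 1) powi (- int (total_degree m)) / of_nat (exponent_fact m))"

lemma exponent_fact_neq_0 [simp]: "exponent_fact n \<noteq> 0"
  by (simp add: exponent_fact_def)

lemma edge_series_0: "mfps_nth (edge_series l y) 0 = 1"
  by (simp add: edge_series_def total_degree_def exponent_fact_def case_prod_unfold)

lemma power_card_multipartite_edges:
  fixes W :: "('i::{finite, linorder} \<times> nat) set" and y :: "'a::field_char_0"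
  assumes "finite W" "y \<noteq> 1"
  shows "y ^ card (multipartite_edges l W) =
    of_nat (exponent_fact (part_sizes W)) * (y - 1) ^ total_degree (part_sizes W) *
      mfps_nth (edge_series l y) (part_sizes W)"
  using assms
  by (simp add: edge_series_def card_multipartite_edges power_int_minus field_simps)

text \<open>
  The coefficient of \<open>F\<^bsup>k+1\<^esup> = F F\<^sup>k\<close> is a convolution over exponent vectors \<open>m \<le> n\<close>, and the number
  of vertex sets \<open>W \<subseteq> V\<close> with part sizes \<open>m\<close> is the product of binomial coefficients that turns
  it into the recursion for the last colour class.
\<close>
lemma sum_colourings_eq_power_edge_series:
  fixes V :: "('i::{finite, linorder} \<times> nat) set" and y :: "'a::field_char_0"
  assumes "finite V" "y \<noteq> 1"
  shows "(\<Sum>\<sigma>\<in>V \<rightarrow>\<^sub>E {..<k}. y ^ card (multipartite_monochromatic l V \<sigma>)) =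
    of_nat (exponent_fact (part_sizes V)) * (y - 1) ^ total_degree (part_sizes V) *
      mfps_nth (edge_series l y ^ k) (part_sizes V)"
  using assms(1)
proof (induction k arbitrary: V)
  case 0
  show ?case
  proof (cases "V = {}")
    case True
    then have "part_sizes V = 0" "multipartite_monochromatic l V \<sigma> = {}" for \<sigma>
      by (simp_all add: part_sizes_def part_def fun_eq_iff
          multipartite_monochromatic_def multipartite_edges_def)
    then show ?thesis
      using True by (simp add: mfps_nth_one exponent_fact_def total_degree_def fun_eq_iff)
  next
    case False
    then obtain v where "v \<in> V"
      by auto
    then have "v \<in> part V (fst v)"
      by (simp add: part_def)
    then have "part_sizes V (fst v) \<noteq> 0"
      using 0 by (auto simp: part_sizes_def)
    then have "part_sizes V \<noteq> 0"
      by auto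
    moreover have "(V \<rightarrow>\<^sub>E {..<0::nat}) = {}"
      using False by (auto simp: PiE_eq_empty_iff)
    ultimately show ?thesis
      by (simp add: mfps_nth_one)
  qed
next
  case (Suc k)
  define n where "n = part_sizes V"
  define F where "F = edge_series l y"
  define w where "w m = of_nat (exponent_fact m) * (y - 1) ^ total_degree m" for m :: "'i \<Rightarrow> nat"
  have "(\<Sum>\<sigma>\<in>V \<rightarrow>\<^sub>E {..<Suc k}. y ^ card (multipartite_monochromatic l V \<sigma>)) =
      (\<Sum>W\<in>Pow V. y ^ card (multipartite_edges l W) *
        (\<Sum>\<tau>\<in>(V - W) \<rightarrow>\<^sub>E {..<k}. y ^ card (multipartite_monochromatic l (V - W) \<tau>)))"
    by (rule sum_colourings_Suc [OF Suc.prems])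
  also have "\<dots> = (\<Sum>W\<in>Pow V. w (part_sizes W) * mfps_nth F (part_sizes W) *
      (w (n - part_sizes W) * mfps_nth (F ^ k) (n - part_sizes W)))"
  proof (rule sum.cong [OF refl])
    fix W assume "W \<in> Pow V"
    then have W: "W \<subseteq> V" "finite W" "finite (V - W)"
      using Suc.prems by (auto intro: finite_subset)
    show "y ^ card (multipartite_edges l W) *
        (\<Sum>\<tau>\<in>(V - W) \<rightarrow>\<^sub>E {..<k}. y ^ card (multipartite_monochromatic l (V - W) \<tau>)) =
      w (part_sizes W) * mfps_nth F (part_sizes W) *
        (w (n - part_sizes W) * mfps_nth (F ^ k) (n - part_sizes W))"
      unfolding Suc.IH [OF W(3)] power_card_multipartite_edges [OF W(2) assms(2)]
        part_sizes_Diff [OF Suc.prems W(1)] w_def n_def F_def ..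
  qed
  also have "\<dots> = (\<Sum>m\<le>n. of_nat (\<Prod>i\<in>UNIV. n i choose m i) *
      (w m * mfps_nth F m * (w (n - m) * mfps_nth (F ^ k) (n - m))))"
    unfolding n_def by (rule sum_Pow_part_sizes [OF Suc.prems])
  also have "\<dots> = (\<Sum>m\<le>n. w n * (mfps_nth F m * mfps_nth (F ^ k) (n - m)))"
  proof (rule sum.cong [OF refl])
    fix m assume "m \<in> {..n}"
    then have "m \<le> n"
      by simp
    then have "w n = of_nat (\<Prod>i\<in>UNIV. n i choose m i) * w m * w (n - m)"
      unfolding w_def total_degree_Diff [OF \<open>m \<le> n\<close>] exponent_fact_choose [OF \<open>m \<le> n\<close>] power_add
        of_nat_mult by (simp only: mult_ac)
    then show "of_nat (\<Prod>i\<in>UNIV. n i choose m i) *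
        (w m * mfps_nth F m * (w (n - m) * mfps_nth (F ^ k) (n - m))) =
      w n * (mfps_nth F m * mfps_nth (F ^ k) (n - m))"
      by (simp only: mult_ac)
  qed
  also have "\<dots> = w n * mfps_nth (F ^ Suc k) n"
    unfolding power_Suc mfps_nth_mult sum_distrib_left ..
  finally show ?case
    unfolding w_def n_def F_def .
qed

lemma finite_multigraph_weighted_multipartite:
  fixes l :: "'i::{finite, linorder} \<Rightarrow> 'i \<Rightarrow> nat"
  shows "finite_multigraph (weighted_multipartite l n)"
proof
  have "edges (weighted_multipartite l n) = multipartite_edges l (SIGMA j:UNIV. {..<n j})"
    by (simp add: weighted_multipartite_def multipartite_edges_def Let_def)
  then show "finite (edges (weighted_multipartite l n))"
    by simp
qed (auto simp: weighted_multipartite_def Let_def)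

text \<open>For \<open>q = k\<close> the Fortuin--Kasteleyn sum is, up to normalization, a coefficient of a \<open>k\<close>-th power.\<close>
lemma sum_num_components_weighted_multipartite:
  fixes l :: "'i::{finite, linorder} \<Rightarrow> 'i \<Rightarrow> nat" and y :: "'a::field_char_0"
  defines "\<Gamma> \<equiv> weighted_multipartite l"
  assumes "y \<noteq> 1"
  shows "(\<Sum>A\<in>Pow (edges (\<Gamma> n)). of_nat k ^ num_components (\<Gamma> n) A * (y - 1) ^ card A) =
    of_nat (exponent_fact n) * (y - 1) ^ total_degree n * mfps_nth (edge_series l y ^ k) n"
proof -
  let ?V = "SIGMA j:UNIV. {..<n j}"
  interpret finite_multigraph "\<Gamma> n"
    unfolding \<Gamma>_def by (rule finite_multigraph_weighted_multipartite)
  have verts: "verts (\<Gamma> n) = ?V"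
    by (simp add: \<Gamma>_def weighted_multipartite_def Let_def)
  have mono: "monochromatic_edges (\<Gamma> n) \<sigma> = multipartite_monochromatic l ?V \<sigma>" for \<sigma>
    by (auto simp: \<Gamma>_def weighted_multipartite_def Let_def monochromatic_edges_def
        multipartite_monochromatic_def multipartite_edges_def)
  have "part ?V i = {i} \<times> {..<n i}" for i
    by (auto simp: part_def)
  then have "part_sizes ?V = n"
    by (simp add: part_sizes_def fun_eq_iff card_cartesian_product)
  then show ?thesis
    using sum_colourings_eq_power_edge_series [of ?V y l k] assms(2)
    by (simp add: sum_num_components_eq_sum_colourings verts mono)
qed

text \<open>Both sides are polynomials in \<open>q\<close> that agree at all natural numbers.\<close>
lemma sum_num_components_eq_mfps_powr:
  fixes l :: "'i::{finite, linorder} \<Rightarrow> 'i \<Rightarrow> nat" and y q :: "'a::field_char_0"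
  defines "\<Gamma> \<equiv> weighted_multipartite l"
  assumes "y \<noteq> 1"
  shows "(\<Sum>A\<in>Pow (edges (\<Gamma> n)). q ^ num_components (\<Gamma> n) A * (y - 1) ^ card A) =
    of_nat (exponent_fact n) * (y - 1) ^ total_degree n *
      mfps_nth (mfps_powr (edge_series l y) q) n"
proof -
  obtain p where p: "mfps_nth (mfps_powr (edge_series l y) c) n = poly p c" for c
    using mfps_nth_powr_eq_poly by metis
  define P where "P = (\<Sum>A\<in>Pow (edges (\<Gamma> n)). monom ((y - 1) ^ card A) (num_components (\<Gamma> n) A))"
  define Q where "Q = smult (of_nat (exponent_fact n) * (y - 1) ^ total_degree n) p"
  have P: "poly P c = (\<Sum>A\<in>Pow (edges (\<Gamma> n)). c ^ num_components (\<Gamma> n) A * (y - 1) ^ card A)" for c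
    by (simp add: P_def poly_sum poly_monom mult.commute)
  have "poly P (of_nat k) = poly Q (of_nat k)" for k
    using sum_num_components_weighted_multipartite [OF assms(2)]
    by (simp add: P Q_def \<Gamma>_def mfps_powr_of_nat edge_series_0 flip: p)
  then have "range of_nat \<subseteq> {c. poly (P - Q) c = 0}"
    by auto
  moreover have "infinite (range (of_nat :: nat \<Rightarrow> 'a))"
    by (simp add: range_inj_infinite inj_of_nat)
  ultimately have "P - Q = 0"
    using poly_roots_finite finite_subset by blast
  then have "poly P q = poly Q q"
    by simp
  then show ?thesis
    by (simp add: P Q_def p)
qed

theorem theorem4p3:
  fixes l :: "'r::{finite, linorder} \<Rightarrow> 'r \<Rightarrow> nat"
    and x y :: "'a::field_char_0"
  assumes "CARD('r) \<ge> 2"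
    and "y \<noteq> 1"
  shows
    "1 + Abs_mfps (\<lambda>n :: 'r \<Rightarrow> nat.
        if n \<noteq> 0
        then (x - 1) ^ num_components (weighted_multipartite l n)
                         (edges (weighted_multipartite l n)) *
             Tutte (weighted_multipartite l n) x y / of_nat (exponent_fact n)
        else 0) =
     mfps_powr
       (Abs_mfps (\<lambda>m :: 'r \<Rightarrow> nat.
          y ^ (\<Sum>(i, j)\<in>{(i, j). i < j}. l i j * m i * m j) *
          (y - 1) powi (- int (total_degree m)) / of_nat (exponent_fact m)))
       ((x - 1) * (y - 1))"
    (is "?lhs = _")
proof -
  let ?F = "edge_series l y" and ?q = "(x - 1) * (y - 1)" and ?\<Gamma> = "weighted_multipartite l"
  have coeff: "(x - 1) ^ num_components (?\<Gamma> n) (edges (?\<Gamma> n)) * Tutte (?\<Gamma> n) x y /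
      of_nat (exponent_fact n) = mfps_nth (mfps_powr ?F ?q) n" for n
  proof -
    interpret finite_multigraph "?\<Gamma> n"
      by (rule finite_multigraph_weighted_multipartite)
    have "card (verts (?\<Gamma> n)) = total_degree n"
      by (simp add: weighted_multipartite_def Let_def total_degree_def)
    then show ?thesis
      using assms(2)
      by (simp add: Tutte_eq_sum_num_components sum_num_components_eq_mfps_powr)
  qed
  have "mfps_nth (mfps_powr ?F ?q) 0 = 1"
    by (simp add: mfps_powr_def mfps_exp_def)
  then have "mfps_nth ?lhs n = mfps_nth (mfps_powr ?F ?q) n" for n
    by (simp add: mfps_nth_one coeff)
  then have "?lhs = mfps_powr ?F ?q"
    by (simp add: mfps_eq_iff)
  then show ?thesis
    by (simp only: edge_series_def)
qed

end
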